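(* $\Sigma^1_1\text{-}\mathsf{LNP}$ is ${\uparrow}D^\ast_\omega(\Sigma^0_1/\Pi^1_1)$-complete.
   Context: $\delta_{\Pi^1_1}:\omega^\omega\to\boldsymbol{\Pi}^1_1(\omega)$ is the total representation of the $\boldsymbol{\Pi}^1_1$ subsets of $\omega$: $\delta_{\Pi^1_1}(e^\frown p)$ is the $e$-th $\Pi^1_1(p)$ subset of $\omega$ (standard effective enumeration); $\boldsymbol{\Sigma}^1_1(\omega)$ is represented by $\delta_{\Sigma^1_1}(x)=\omega\setminus\delta_{\Pi^1_1}(x)$. $\Sigma^1_1\text{-}\mathsf{LNP}:\subseteq\boldsymbol{\Sigma}^1_1(\omega)\to\omega$ is the partial function with $\Sigma^1_1\text{-}\mathsf{LNP}(A)=\min A$ if $A\ne\emptyset$, undefined if $A=\emptyset$. For a decreasing sequence $(B_n)_{n<\omega}$ of subsets of $\omega^\omega$ and a sequence $(f_n)_{n<\omega}$ of partial functions $f_n:\subseteq\omega^\omega\to\omega$, the partial function ${\uparrow}\mathbb{D}^\ast_{n<\omega}[f_n/B_n]$ sends $x$ to $f_m(x)$ if $m=\max\{n<\omega:x\in B_n\}$ exists, and is undefined at $x$ otherwise. ${\uparrow}D^\ast_\omega(\Sigma^0_1/\Pi^1_1)$ is the class of all partial functions ${\uparrow}\mathbb{D}^\ast_{n<\omega}[f_n/B_n]$ with $(B_n)$ a uniformly $\Pi^1_1$ decreasing sequence of subsets of $\omega^\omega$ and $(f_n)$ a computable sequence of (partial) computable functions. Weihrauch reducibility: for partial (multivalued)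 functions $f,g$ between represented spaces, $f\le_{\mathsf W}g$ if there are partial computable $h,k$ on $\omega^\omega$ such that for every name $\mathtt{x}$ of some $x\in{\rm dom}(f)$, $h(\mathtt{x})$ is a name of some $x^\ast\in{\rm dom}(g)$, and whenever $\mathtt{y}$ is a name of an element of $g(x^\ast)$, $k(\mathtt{x},\mathtt{y})$ is a name of an element of $f(x)$. ($\omega$ and $\omega^\omega$ carry their standard representations.) For a class $\mathcal{F}$ of partial functions $\omega^\omega\to\omega$ and a represented space $(X,\delta_X)$, a partial function $f:\subseteq X\to\omega$ is $\mathcal{F}$-complete if $f\circ\delta_X\in\mathcal{F}$ and every $g\in\mathcal{F}$ satisfies $g\le_{\mathsf W}f$. *)

theory Defs
  imports Main "HOL-Library.Nat_Bijection"
begin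

section \<open>Computability relative to an oracle\<close>

type_synonym baire = "nat \<Rightarrow> nat"

text \<open>
  Programs for the partial recursive functions of one number argument relative to an
  oracle in Baire space. Several arguments are passed through the pairing function
  \<^const>\<open>prod_encode\<close>: \<open>Primrec b s\<close> computes \<open>h(a,0) = b(a)\<close>,
  \<open>h(a,n+1) = s(a,(n,h(a,n)))\<close>, and \<open>Mu c\<close> searches, on input \<open>x\<close>, for the least \<open>n\<close>
  with \<open>c(x,n) = 0\<close>.
\<close>

datatype prog =
    Zero | Succ | First | Second | Oracle
  | Tuple prog prog | Comp prog prog | Primrec prog prog | Mu prog

primrec eval :: "prog \<Rightarrow> baire \<Rightarrow> nat \<rightharpoonup> nat" where
  "eval Zero p x = Some 0"
| "eval Succ p x = Some (Suc x)"
| "eval First p x = Some (fst (prod_decode x))"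
| "eval Second p x = Some (snd (prod_decode x))"
| "eval Oracle p x = Some (p x)"
| "eval (Tuple c d) p x =
     Option.bind (eval c p x) (\<lambda>u. Option.bind (eval d p x) (\<lambda>v. Some (prod_encode (u, v))))"
| "eval (Comp c d) p x = Option.bind (eval d p x) (eval c p)"
| "eval (Primrec b s) p x =
     (case prod_decode x of (a, n) \<Rightarrow>
        rec_nat (eval b p a)
          (\<lambda>i r. Option.bind r (\<lambda>v. eval s p (prod_encode (a, prod_encode (i, v))))) n)"
| "eval (Mu c) p x =
     (if \<exists>n. eval c p (prod_encode (x, n)) = Some 0 \<and>
             (\<forall>m<n. eval c p (prod_encode (x, m)) \<noteq> None)
      then Some (LEAST n. eval c p (prod_encode (x, n)) = Some 0) else None)"

primrec code :: "prog \<Rightarrow> nat" where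
  "code Zero = 0"
| "code Succ = 1"
| "code First = 2"
| "code Second = 3"
| "code Oracle = 4"
| "code (Tuple c d) = 5 + 4 * prod_encode (code c, code d)"
| "code (Comp c d) = 6 + 4 * prod_encode (code c, code d)"
| "code (Primrec c d) = 7 + 4 * prod_encode (code c, code d)"
| "code (Mu c) = 8 + 4 * code c"

lemma inj_code: "inj code"
proof -
  have [simp]: "5 + 4 * (m::nat) \<noteq> 6 + 4 * n" "5 + 4 * m \<noteq> 7 + 4 * n" "5 + 4 * m \<noteq> 8 + 4 * n"
    "6 + 4 * m \<noteq> 7 + 4 * n" "6 + 4 * m \<noteq> 8 + 4 * n" "7 + 4 * m \<noteq> 8 + 4 * n" for m n
    by presburger+
  note [simp] = this[THEN not_sym]
  have "code c = code d \<Longrightarrow> c = d" for c d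
  proof (induction c arbitrary: d)
  qed (case_tac d; force simp: prod_encode_eq)+
  then show ?thesis by (simp add: inj_on_def)
qed

lemma surj_code: "surj code"
proof -
  have "\<exists>c. code c = n" for n
  proof (induction n rule: less_induct)
    case (less n)
    show ?case
    proof (cases "n < 5")
      case True
      then have "n = 0 \<or> n = 1 \<or> n = 2 \<or> n = 3 \<or> n = 4" by auto
      then show ?thesis using code.simps(1-5) by metis
    next
      case False
      define q r where "q = (n - 5) div 4" and "r = (n - 5) mod 4"
      obtain a b where ab: "prod_encode (a, b) = q"
        by (metis prod_decode_inverse surj_pair)
      have n: "n = 5 + r + 4 * q" and r: "r < 4"
        using False by (auto simp: q_def r_def)
      have "a < n" "b < n" "q < n"
        using le_prod_encode_1[of a b] le_prod_encode_2[of b a] ab n by linarith+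
      then obtain c d e where "code c = a" "code d = b" "code e = q" using less by metis
      moreover have "r = 0 \<or> r = 1 \<or> r = 2 \<or> r = 3" using r by auto
      ultimately have "code (Tuple c d) = n \<or> code (Comp c d) = n \<or> code (Primrec c d) = n \<or> code (Mu e) = n"
        using n ab by auto
      then show ?thesis by blast
    qed
  qed
  then show ?thesis by (metis surjI)
qed

text \<open>The program with index \<open>e\<close>; \<^const>\<open>code\<close> is a bijection.\<close>

definition prog_of :: "nat \<Rightarrow> prog" where
  "prog_of = inv code"

definition join :: "baire \<Rightarrow> baire \<Rightarrow> baire" where
  "join p q n = (if even n then p (n div 2) else q (n div 2))"

definition eval_baire :: "prog \<Rightarrow> baire \<rightharpoonup> baire" where
  "eval_baire c p =
     (if \<forall>n. eval c p n \<noteq> None then Some (\<lambda>n. the (eval c p n)) else None)"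

definition partial_computable :: "(baire \<rightharpoonup> baire) \<Rightarrow> bool" where
  "partial_computable F \<longleftrightarrow> (\<exists>c. F = eval_baire c)"

text \<open>A single program computes \<open>f n x\<close> from \<open>n\<close> and the oracle \<open>x\<close>.\<close>

definition computable_sequence :: "(nat \<Rightarrow> baire \<rightharpoonup> nat) \<Rightarrow> bool" where
  "computable_sequence f \<longleftrightarrow> (\<exists>c. \<forall>n x. f n x = eval c x n)"


section \<open>The pointclass \<open>\<Pi>\<^sup>1\<^sub>1\<close>\<close>

text \<open>
  \<open>\<forall>f\<in>\<omega>\<^sup>\<omega>. n \<in> W(p \<oplus> f)\<close>, where \<open>W(q)\<close>, the domain of the program with oracle \<open>q\<close>, is the
  general form of a \<open>\<Sigma>\<^sup>0\<^sub>1(q)\<close> subset of \<open>\<omega>\<close>.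
\<close>

definition Pi11_set :: "prog \<Rightarrow> baire \<Rightarrow> nat set" where
  "Pi11_set c p = {n. \<forall>f. n \<in> dom (eval c (join p f))}"

definition delta_Pi11 :: "baire \<Rightarrow> nat set" where
  "delta_Pi11 x = Pi11_set (prog_of (x 0)) (\<lambda>n. x (Suc n))"

definition delta_Sigma11 :: "baire \<Rightarrow> nat set" where
  "delta_Sigma11 x = - delta_Pi11 x"

text \<open>\<open>{(n, x). x \<in> B n}\<close> is a lightface \<open>\<Pi>\<^sup>1\<^sub>1\<close> subset of \<open>\<omega> \<times> \<omega>\<^sup>\<omega>\<close>.\<close>

definition uniformly_Pi11 :: "(nat \<Rightarrow> baire set) \<Rightarrow> bool" where
  "uniformly_Pi11 B \<longleftrightarrow> (\<exists>c. \<forall>n x. x \<in> B n \<longleftrightarrow> n \<in> Pi11_set c x)"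

text \<open>
  Boldface \<open>\<Sigma>\<^sup>1\<^sub>1(\<omega>)\<close> is the full power set of \<open>\<omega>\<close>, so the type \<^typ>\<open>nat set\<close> is exactly the
  space represented by \<^const>\<open>delta_Sigma11\<close>.
\<close>

lemma surj_delta_Sigma11: "surj delta_Sigma11"
proof -
  define dbl where "dbl = Comp (Primrec Zero (Comp Succ (Comp Succ (Comp Second Second)))) (Tuple First First)"
  define c where "c = Mu (Comp Oracle dbl)"
  have rec: "rec_nat (Some 0) (\<lambda>i r. Option.bind r (\<lambda>v. Some (Suc (Suc v)))) n = Some (2 * n)" for n :: nat
    by (induction n) auto
  have dbl: "eval dbl p (prod_encode (n, k)) = Some (2 * n)" for p n k
    by (simp add: dbl_def rec)
  have c: "n \<in> dom (eval c p) \<longleftrightarrow> p (2 * n) = 0" for p n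
    by (auto simp: c_def dbl domIff)
  have "\<exists>x. delta_Sigma11 x = A" for A
  proof
    define x where "x = case_nat (code c) (\<lambda>n. if n \<in> A then 1 else 0)"
    have "prog_of (x 0) = c" by (simp add: x_def prog_of_def inj_code)
    then show "delta_Sigma11 x = A"
      by (auto simp: delta_Sigma11_def delta_Pi11_def Pi11_set_def c join_def x_def)
  qed
  then show ?thesis by (metis surjI)
qed

definition Sigma11_LNP :: "nat set \<rightharpoonup> nat" where
  "Sigma11_LNP A = (if A \<noteq> {} then Some (LEAST n. n \<in> A) else None)"


section \<open>The class \<open>\<up>D\<^sup>*\<^sub>\<omega>(\<Sigma>\<^sup>0\<^sub>1/\<Pi>\<^sup>1\<^sub>1)\<close>\<close>

text \<open>A set of natural numbers has a maximum iff it is finite and nonempty.\<close>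

definition up_diff :: "(nat \<Rightarrow> baire \<rightharpoonup> nat) \<Rightarrow> (nat \<Rightarrow> baire set) \<Rightarrow> baire \<rightharpoonup> nat" where
  "up_diff f B x =
     (if finite {n. x \<in> B n} \<and> {n. x \<in> B n} \<noteq> {} then f (Max {n. x \<in> B n}) x else None)"

definition up_D_omega_Sigma01_Pi11 :: "(baire \<rightharpoonup> nat) set" where
  "up_D_omega_Sigma01_Pi11 =
     {up_diff f B | f B. antimono B \<and> uniformly_Pi11 B \<and> computable_sequence f}"


section \<open>Weihrauch reducibility and completeness\<close>

text \<open>
  A representation is a partial map from Baire space, with range the represented space.
  A partial multivalued function is a set-valued one, defined where the value is nonempty.
\<close>

type_synonym 'a representation = "baire \<rightharpoonup> 'a"

definition rep_nat :: "nat representation" where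
  "rep_nat p = Some (p 0)"

definition rep_baire :: "baire representation" where
  "rep_baire p = Some p"

definition rep_Sigma11 :: "nat set representation" where
  "rep_Sigma11 p = Some (delta_Sigma11 p)"

definition weihrauch_le ::
  "'x representation \<Rightarrow> 'y representation \<Rightarrow> ('x \<Rightarrow> 'y set) \<Rightarrow>
   'u representation \<Rightarrow> 'v representation \<Rightarrow> ('u \<Rightarrow> 'v set) \<Rightarrow> bool" where
  "weihrauch_le \<delta>X \<delta>Y f \<delta>U \<delta>V g \<longleftrightarrow>
     (\<exists>h k. partial_computable h \<and> partial_computable k \<and>
        (\<forall>p x. \<delta>X p = Some x \<and> f x \<noteq> {} \<longrightarrow>
           (\<exists>q u. h p = Some q \<and> \<delta>U q = Some u \<and> g u \<noteq> {} \<and>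
              (\<forall>r v. \<delta>V r = Some v \<and> v \<in> g u \<longrightarrow>
                 (\<exists>s y. k (join p r) = Some s \<and> \<delta>Y s = Some y \<and> y \<in> f x)))))"

definition complete_for :: "(baire \<rightharpoonup> nat) set \<Rightarrow> 'x representation \<Rightarrow> ('x \<rightharpoonup> nat) \<Rightarrow> bool" where
  "complete_for \<F> \<delta>X f \<longleftrightarrow>
     f \<circ>\<^sub>m \<delta>X \<in> \<F> \<and>
     (\<forall>g\<in>\<F>. weihrauch_le rep_baire rep_nat (\<lambda>x. set_option (g x))
                          \<delta>X rep_nat (\<lambda>x. set_option (f x)))"

end

theory Submission
  imports Defs
begin

text \<open>
  Write \<open>P\<close> for the \<open>\<Pi>\<^sup>1\<^sub>1\<close> set named by \<open>x\<close>. The minimum of the complement of \<open>P\<close> is the maximal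
  \<open>n\<close> with \<open>{..<n} \<subseteq> P\<close>, which gives membership in the class as soon as \<open>{..<n} \<subseteq> P\<close> is
  a uniformly \<open>\<Pi>\<^sup>1\<^sub>1\<close> condition. For the latter no universal program is needed: the graph of the evaluation
  function is the least set closed under finitely many decidable rules, so that an evaluation
  halts iff every set \<open>E\<close> closed under the rules says so. The quantifier over \<open>E\<close> is absorbed
  by the function quantifier of \<open>\<Pi>\<^sup>1\<^sub>1\<close>, and a violated rule is found by unbounded search.

  Conversely, if \<open>m\<close> is maximal with \<open>x \<in> B m\<close>, then \<open>m\<close> is the least element of the \<open>\<Sigma>\<^sup>1\<^sub>1\<close> set
  \<open>{n. x \<notin> B (n + 1)}\<close>, a name of which is computable from \<open>x\<close>.
\<close>

section \<open>Programs\<close>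

lemma join_even [simp]: "join p q (2 * n) = p n"
  by (simp add: join_def)

lemma join_odd [simp]: "join p q (Suc (2 * n)) = q n"
  by (simp add: join_def)

lemma join_0 [simp]: "join p q 0 = p 0"
  by (simp add: join_def)

definition Id_prog :: prog where
  "Id_prog = Tuple First Second"

lemma eval_Id_prog [simp]: "eval Id_prog p n = Some n"
  by (simp add: Id_prog_def)

definition double :: "prog \<Rightarrow> prog" where
  "double t = Comp (Primrec Zero (Comp Succ (Comp Succ (Comp Second Second)))) (Tuple Zero t)"

lemma eval_double [simp]: "eval (double t) p n = map_option (\<lambda>k. 2 * k) (eval t p n)"
proof -
  have "rec_nat (Some 0) (\<lambda>i r. Option.bind r (\<lambda>v. Some (Suc (Suc v)))) k = Some (2 * k)" for k :: nat
    by (induction k) auto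
  then show ?thesis by (cases "eval t p n") (auto simp: double_def)
qed

definition plus_const :: "nat \<Rightarrow> prog \<Rightarrow> prog" where
  "plus_const k t = (Comp Succ ^^ k) t"

lemma eval_plus_const [simp]: "eval (plus_const k t) p n = map_option (\<lambda>m. k + m) (eval t p n)"
  unfolding plus_const_def by (induction k) (cases "eval t p n"; simp)+

text \<open>The step discards the counter and the previous value, so every positive value of
  \<open>t\<close> selects \<open>b\<close>. Even then the recursion runs \<open>a\<close> first,
  which is why \<open>eval_Cond\<close> asks that both branches be defined.\<close>

definition Cond :: "prog \<Rightarrow> prog \<Rightarrow> prog \<Rightarrow> prog" where
  "Cond t a b = Comp (Primrec a (Comp b First)) (Tuple Id_prog t)"

lemma eval_Cond:
  assumes "eval t p n = Some k" "eval a p n = Some u" "eval b p n = Some v"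
  shows "eval (Cond t a b) p n = Some (if k = 0 then u else v)"
proof -
  have "rec_nat (Some u) (\<lambda>i r. Option.bind r (\<lambda>_. Some v)) k = Some (if k = 0 then u else v)"
    by (induction k) auto
  with assms show ?thesis by (simp add: Cond_def)
qed

text \<open>Lets a program meant for oracle \<open>q\<close> run relative to an oracle
  \<open>p\<close> from which \<open>t\<close> computes \<open>q\<close>; the decoding map of the
  reduction needs this.\<close>

primrec subst_oracle :: "prog \<Rightarrow> prog \<Rightarrow> prog" where
  "subst_oracle t Zero = Zero"
| "subst_oracle t Succ = Succ"
| "subst_oracle t First = First"
| "subst_oracle t Second = Second"
| "subst_oracle t Oracle = t"
| "subst_oracle t (Tuple c d) = Tuple (subst_oracle t c) (subst_oracle t d)"
| "subst_oracle t (Comp c d) = Comp (subst_oracle t c) (subst_oracle t d)"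
| "subst_oracle t (Primrec c d) = Primrec (subst_oracle t c) (subst_oracle t d)"
| "subst_oracle t (Mu c) = Mu (subst_oracle t c)"

lemma eval_subst_oracle:
  assumes "\<And>n. eval t p n = Some (q n)"
  shows "eval (subst_oracle t c) p = eval c q"
proof (induction c)
  case (Comp c d)
  then show ?case by simp
qed (auto simp: assms fun_eq_iff)

lemma prog_of_code [simp]: "prog_of (code c) = c"
  by (simp add: prog_of_def inj_code)

lemma code_prog_of [simp]: "code (prog_of e) = e"
  by (simp add: prog_of_def surj_code surj_f_inv_f)

lemma prog_of_simps [simp]:
  "prog_of 0 = Zero" "prog_of (Suc 0) = Succ" "prog_of 2 = First" "prog_of 3 = Second"
  "prog_of 4 = Oracle"
  "prog_of (5 + 4 * prod_encode (c, d)) = Tuple (prog_of c) (prog_of d)"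
  "prog_of (6 + 4 * prod_encode (c, d)) = Comp (prog_of c) (prog_of d)"
  "prog_of (7 + 4 * prod_encode (c, d)) = Primrec (prog_of c) (prog_of d)"
  "prog_of (8 + 4 * c) = Mu (prog_of c)"
  using prog_of_code[of Zero] prog_of_code[of Succ] prog_of_code[of First] prog_of_code[of Second]
    prog_of_code[of Oracle] prog_of_code[of "Tuple (prog_of c) (prog_of d)"]
    prog_of_code[of "Comp (prog_of c) (prog_of d)"]
    prog_of_code[of "Primrec (prog_of c) (prog_of d)"] prog_of_code[of "Mu (prog_of c)"]
  by (simp_all del: prog_of_code)

text \<open>Trades the \<open>LEAST\<close> of the semantics for conditions matching the
  \<open>nz\<close> judgements: before the first zero all values are defined, hence
  positive.\<close>

lemma eval_Mu_eq_Some: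
  "eval (Mu c) p a = Some n \<longleftrightarrow>
     eval c p (prod_encode (a, n)) = Some 0 \<and>
     (\<forall>m<n. \<exists>v. eval c p (prod_encode (a, m)) = Some (Suc v))" (is "?L \<longleftrightarrow> ?R")
proof
  let ?P = "\<lambda>n. eval c p (prod_encode (a, n)) = Some 0"
  assume L: ?L
  then obtain k where k: "?P k" "\<forall>m<k. eval c p (prod_encode (a, m)) \<noteq> None"
    and n: "n = (LEAST n. ?P n)"
    by (auto split: if_splits)
  have "\<exists>v. eval c p (prod_encode (a, m)) = Some (Suc v)" if "m < n" for m
  proof -
    have "m < k" using that n Least_le[of ?P, OF k(1)] by simp
    then obtain v where "eval c p (prod_encode (a, m)) = Some v" using k(2) by auto
    moreover have "v \<noteq> 0" using calculation not_less_Least[of m ?P] that n by auto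
    ultimately show ?thesis by (cases v) auto
  qed
  with LeastI[of ?P, OF k(1)] n show ?R by blast
next
  let ?P = "\<lambda>n. eval c p (prod_encode (a, n)) = Some 0"
  assume R: ?R
  then have "(LEAST n. ?P n) = n"
    by (intro Least_equality) (auto simp: not_less[symmetric])
  moreover have "\<forall>m<n. eval c p (prod_encode (a, m)) \<noteq> None"
    using R by force
  ultimately show ?L using R by auto
qed

section \<open>Evaluation as the least set closed under rules\<close>

text \<open>
  Judgements, coded as numbers: \<open>ev c a v\<close> for ``program \<open>c\<close> yields \<open>v\<close> on \<open>a\<close>'', \<open>nz c a n\<close> for
  ``\<open>c\<close> yields a nonzero value on \<open>(a, m)\<close> for all \<open>m < n\<close>'', and \<open>halts_below n\<close> for
  ``program \<open>x 0\<close> halts on all \<open>m < n\<close>''.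
\<close>

definition ev :: "nat \<Rightarrow> nat \<Rightarrow> nat \<Rightarrow> nat" where
  "ev c a v = prod_encode (0, prod_encode (c, prod_encode (a, v)))"

definition nz :: "nat \<Rightarrow> nat \<Rightarrow> nat \<Rightarrow> nat" where
  "nz c a n = prod_encode (1, prod_encode (c, prod_encode (a, n)))"

definition halts_below :: "nat \<Rightarrow> nat" where
  "halts_below n = prod_encode (2, n)"

text \<open>The oracle of the evaluated program \<open>x 0\<close> is \<open>join (\<lambda>n. x (Suc n)) f\<close>.\<close>

definition closed_at ::
  "baire \<Rightarrow> baire \<Rightarrow> nat set \<Rightarrow> nat \<Rightarrow> nat \<Rightarrow> nat \<Rightarrow> nat \<Rightarrow> nat \<Rightarrow> nat \<Rightarrow> bool" where
  "closed_at x f S c d a k u v \<longleftrightarrow>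
     ev 0 a 0 \<in> S \<and>
     ev 1 a (Suc a) \<in> S \<and>
     ev 2 (prod_encode (a, u)) a \<in> S \<and>
     ev 3 (prod_encode (a, u)) u \<in> S \<and>
     ev 4 (2 * a) (x (Suc a)) \<in> S \<and>
     ev 4 (Suc (2 * a)) (f a) \<in> S \<and>
     (ev c a u \<in> S \<and> ev d a v \<in> S \<longrightarrow>
        ev (5 + 4 * prod_encode (c, d)) a (prod_encode (u, v)) \<in> S) \<and>
     (ev d a u \<in> S \<and> ev c u v \<in> S \<longrightarrow>
        ev (6 + 4 * prod_encode (c, d)) a v \<in> S) \<and>
     (ev c a v \<in> S \<longrightarrow>
        ev (7 + 4 * prod_encode (c, d)) (prod_encode (a, 0)) v \<in> S) \<and>
     (ev (7 + 4 * prod_encode (c, d)) (prod_encode (a, k)) u \<in> S \<and>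
        ev d (prod_encode (a, prod_encode (k, u))) v \<in> S \<longrightarrow>
        ev (7 + 4 * prod_encode (c, d)) (prod_encode (a, Suc k)) v \<in> S) \<and>
     nz c a 0 \<in> S \<and>
     (nz c a k \<in> S \<and> ev c (prod_encode (a, k)) (Suc v) \<in> S \<longrightarrow>
        nz c a (Suc k) \<in> S) \<and>
     (nz c a k \<in> S \<and> ev c (prod_encode (a, k)) 0 \<in> S \<longrightarrow>
        ev (8 + 4 * c) a k \<in> S) \<and>
     halts_below 0 \<in> S \<and>
     (halts_below k \<in> S \<and> ev (x 0) k v \<in> S \<longrightarrow>
        halts_below (Suc k) \<in> S)"

definition eval_closed :: "baire \<Rightarrow> baire \<Rightarrow> nat set \<Rightarrow> bool" where
  "eval_closed x f S \<longleftrightarrow> (\<forall>c d a k u v. closed_at x f S c d a k u v)"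

lemma eval_closedD:
  assumes "eval_closed x f S"
  shows
    "ev 0 a 0 \<in> S"
    "ev 1 a (Suc a) \<in> S"
    "ev 2 (prod_encode (a, u)) a \<in> S"
    "ev 3 (prod_encode (a, u)) u \<in> S"
    "ev 4 (2 * a) (x (Suc a)) \<in> S"
    "ev 4 (Suc (2 * a)) (f a) \<in> S"
    "ev c a u \<in> S \<Longrightarrow> ev d a v \<in> S \<Longrightarrow>
      ev (5 + 4 * prod_encode (c, d)) a (prod_encode (u, v)) \<in> S"
    "ev d a u \<in> S \<Longrightarrow> ev c u v \<in> S \<Longrightarrow>
      ev (6 + 4 * prod_encode (c, d)) a v \<in> S"
    "ev c a v \<in> S \<Longrightarrow>
      ev (7 + 4 * prod_encode (c, d)) (prod_encode (a, 0)) v \<in> S"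
    "ev (7 + 4 * prod_encode (c, d)) (prod_encode (a, k)) u \<in> S \<Longrightarrow>
      ev d (prod_encode (a, prod_encode (k, u))) v \<in> S \<Longrightarrow>
      ev (7 + 4 * prod_encode (c, d)) (prod_encode (a, Suc k)) v \<in> S"
    "nz c a 0 \<in> S"
    "nz c a k \<in> S \<Longrightarrow> ev c (prod_encode (a, k)) (Suc v) \<in> S \<Longrightarrow>
      nz c a (Suc k) \<in> S"
    "nz c a k \<in> S \<Longrightarrow> ev c (prod_encode (a, k)) 0 \<in> S \<Longrightarrow>
      ev (8 + 4 * c) a k \<in> S"
    "halts_below 0 \<in> S"
    "halts_below k \<in> S \<Longrightarrow> ev (x 0) k v \<in> S \<Longrightarrow>
      halts_below (Suc k) \<in> S"
proof -
  have *: "closed_at x f S c d a k u v" for c d a k u v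
    using assms by (simp add: eval_closed_def)
  from *[of c d a k u v] show
    "ev 0 a 0 \<in> S"
    "ev 1 a (Suc a) \<in> S"
    "ev 2 (prod_encode (a, u)) a \<in> S"
    "ev 3 (prod_encode (a, u)) u \<in> S"
    "ev 4 (2 * a) (x (Suc a)) \<in> S"
    "ev 4 (Suc (2 * a)) (f a) \<in> S"
    "ev c a u \<in> S \<Longrightarrow> ev d a v \<in> S \<Longrightarrow>
      ev (5 + 4 * prod_encode (c, d)) a (prod_encode (u, v)) \<in> S"
    "ev d a u \<in> S \<Longrightarrow> ev c u v \<in> S \<Longrightarrow>
      ev (6 + 4 * prod_encode (c, d)) a v \<in> S"
    "ev c a v \<in> S \<Longrightarrow>
      ev (7 + 4 * prod_encode (c, d)) (prod_encode (a, 0)) v \<in> S"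
    "ev (7 + 4 * prod_encode (c, d)) (prod_encode (a, k)) u \<in> S \<Longrightarrow>
      ev d (prod_encode (a, prod_encode (k, u))) v \<in> S \<Longrightarrow>
      ev (7 + 4 * prod_encode (c, d)) (prod_encode (a, Suc k)) v \<in> S"
    "nz c a 0 \<in> S"
    "nz c a k \<in> S \<Longrightarrow> ev c (prod_encode (a, k)) (Suc v) \<in> S \<Longrightarrow>
      nz c a (Suc k) \<in> S"
    "nz c a k \<in> S \<Longrightarrow> ev c (prod_encode (a, k)) 0 \<in> S \<Longrightarrow>
      ev (8 + 4 * c) a k \<in> S"
    "halts_below 0 \<in> S"
    "halts_below k \<in> S \<Longrightarrow> ev (x 0) k v \<in> S \<Longrightarrow>
      halts_below (Suc k) \<in> S"
    by (simp_all add: closed_at_def)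
qed

text \<open>Completeness of the rules: each clause of \<open>eval\<close> is covered by them. Inside
  the induction on programs, \<open>Primrec\<close> and \<open>Mu\<close> need an inner induction on
  the counter.\<close>

lemma eval_closed_ev:
  assumes S: "eval_closed x f S"
  shows "eval c (join (\<lambda>n. x (Suc n)) f) a = Some v \<Longrightarrow> ev (code c) a v \<in> S"
proof (induction c arbitrary: a v)
  case Oracle
  show ?case
  proof (cases "even a")
    case True
    then obtain k where "a = 2 * k" by (auto elim: evenE)
    then show ?thesis using Oracle eval_closedD(5)[OF S] by auto
  next
    case False
    then obtain k where "a = Suc (2 * k)" by (auto elim: oddE)
    then show ?thesis using Oracle eval_closedD(6)[OF S] by auto
  qed
next
  case First
  obtain y z where "a = prod_encode (y, z)" by (metis prod_decode_inverse surj_pair)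
  then show ?case using First eval_closedD(3)[OF S] by auto
next
  case Second
  obtain y z where "a = prod_encode (y, z)" by (metis prod_decode_inverse surj_pair)
  then show ?case using Second eval_closedD(4)[OF S] by auto
next
  case (Tuple c d)
  then show ?case by (auto simp: bind_eq_Some_conv intro!: eval_closedD(7)[OF S])
next
  case (Comp c d)
  obtain u where "eval d (join (\<lambda>n. x (Suc n)) f) a = Some u"
    "eval c (join (\<lambda>n. x (Suc n)) f) u = Some v"
    using Comp.prems by (auto simp: bind_eq_Some_conv)
  then have "ev (code d) a u \<in> S" "ev (code c) u v \<in> S" by (simp_all add: Comp.IH)
  then show ?case using eval_closedD(8)[OF S] by simp
next
  case (Primrec b s)
  let ?q = "join (\<lambda>n. x (Suc n)) f"
  obtain y k where a: "a = prod_encode (y, k)" by (metis prod_decode_inverse surj_pair)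
  have "eval (Primrec b s) ?q (prod_encode (y, n)) = Some w \<Longrightarrow>
      ev (code (Primrec b s)) (prod_encode (y, n)) w \<in> S" for n w
  proof (induction n arbitrary: w)
    case 0
    then have "ev (code b) y w \<in> S" using Primrec.IH(1) by simp
    then show ?case using eval_closedD(9)[OF S] by simp
  next
    case (Suc n)
    then obtain u where u: "eval (Primrec b s) ?q (prod_encode (y, n)) = Some u"
      and "eval s ?q (prod_encode (y, prod_encode (n, u))) = Some w"
      by (auto simp: bind_eq_Some_conv)
    then have "ev (code s) (prod_encode (y, prod_encode (n, u))) w \<in> S"
      using Primrec.IH(2) by blast
    then show ?case using eval_closedD(10)[OF S] Suc.IH[OF u] by simp
  qed
  then show ?case using Primrec.prems a by blast
next
  case (Mu c)
  let ?q = "join (\<lambda>n. x (Suc n)) f"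
  have v: "eval c ?q (prod_encode (a, v)) = Some 0"
    and below: "\<And>m. m < v \<Longrightarrow> \<exists>u. eval c ?q (prod_encode (a, m)) = Some (Suc u)"
    using Mu.prems unfolding eval_Mu_eq_Some by blast+
  \<comment> \<open>Each rule has a fixed number of premises, so the positive values below
    \<open>v\<close> are collected one at a time in \<open>nz\<close>.\<close>
  have "n \<le> v \<Longrightarrow> nz (code c) a n \<in> S" for n
  proof (induction n)
    case 0
    show ?case by (rule eval_closedD(11)[OF S])
  next
    case (Suc n)
    then obtain u where "ev (code c) (prod_encode (a, n)) (Suc u) \<in> S"
      using below[of n] Mu.IH by (auto simp: Suc_le_eq)
    then show ?case using Suc eval_closedD(12)[OF S] by simp
  qed
  then show ?case using Mu.IH[OF v] eval_closedD(13)[OF S] by simp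
qed (use eval_closedD(1,2)[OF S] in auto)

lemma eval_closed_halts_below:
  assumes S: "eval_closed x f S"
    and "{..<n} \<subseteq> dom (eval (prog_of (x 0)) (join (\<lambda>n. x (Suc n)) f))"
  shows "halts_below n \<in> S"
  using assms(2)
proof (induction n)
  case 0
  show ?case by (rule eval_closedD(14)[OF S])
next
  case (Suc n)
  have "n \<in> dom (eval (prog_of (x 0)) (join (\<lambda>n. x (Suc n)) f))" using Suc.prems by blast
  then obtain v where "eval (prog_of (x 0)) (join (\<lambda>n. x (Suc n)) f) n = Some v"
    by (auto simp: domIff)
  then have "ev (x 0) n v \<in> S" using eval_closed_ev[OF S] by fastforce
  moreover have "halts_below n \<in> S" using Suc by (simp add: lessThan_Suc)
  ultimately show ?case using eval_closedD(15)[OF S] by blast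
qed

definition true_judgements :: "nat \<Rightarrow> baire \<Rightarrow> nat set" where
  "true_judgements e q =
     {ev c a v | c a v. eval (prog_of c) q a = Some v} \<union>
     {nz c a n | c a n. \<forall>m<n. \<exists>v. eval (prog_of c) q (prod_encode (a, m)) = Some (Suc v)} \<union>
     {halts_below n | n. {..<n} \<subseteq> dom (eval (prog_of e) q)}"

lemma true_judgements_iff [simp]:
  "ev c a v \<in> true_judgements e q \<longleftrightarrow> eval (prog_of c) q a = Some v"
  "nz c a n \<in> true_judgements e q \<longleftrightarrow>
     (\<forall>m<n. \<exists>v. eval (prog_of c) q (prod_encode (a, m)) = Some (Suc v))"
  "halts_below n \<in> true_judgements e q \<longleftrightarrow> {..<n} \<subseteq> dom (eval (prog_of e) q)"
  by (auto simp: true_judgements_def ev_def nz_def halts_below_def prod_encode_eq)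

text \<open>Soundness of the rules, clause by clause. For \<open>Mu\<close>, the simplifier must use
  \<open>eval_Mu_eq_Some\<close> rather than unfold the \<open>LEAST\<close>.\<close>

lemma eval_closed_true_judgements:
  "eval_closed x f (true_judgements (x 0) (join (\<lambda>n. x (Suc n)) f))"
  unfolding eval_closed_def closed_at_def
  by (simp add: eval_Mu_eq_Some less_Suc_eq lessThan_Suc domIff del: eval.simps(9))

section \<open>Searching for a violated rule\<close>

definition var :: "nat \<Rightarrow> prog" where
  "var i = Comp First (((\<lambda>t. Comp Second t) ^^ i) Id_prog)"

text \<open>The argument \<open>z\<close> is padding: it makes every variable a first projection.\<close>

definition env :: "nat \<Rightarrow> nat \<Rightarrow> nat \<Rightarrow> nat \<Rightarrow> nat \<Rightarrow> nat \<Rightarrow> nat \<Rightarrow> nat \<Rightarrow> nat" where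
  "env n c d a k u v z = prod_encode (n, prod_encode (c, prod_encode (d, prod_encode (a,
     prod_encode (k, prod_encode (u, prod_encode (v, z)))))))"

text \<open>Pairing is surjective, so a single search variable runs through all instances of all
  rules.\<close>

lemma ex_env: "(\<exists>w. P (prod_encode (n, w))) \<longleftrightarrow> (\<exists>c d a k u v z. P (env n c d a k u v z))"
  unfolding env_def by (metis prod_decode_inverse surj_pair)

lemma eval_var [simp]:
  "eval (var 0) p (env n c d a k u v z) = Some n"
  "eval (var (Suc 0)) p (env n c d a k u v z) = Some c"
  "eval (var 2) p (env n c d a k u v z) = Some d"
  "eval (var 3) p (env n c d a k u v z) = Some a"
  "eval (var 4) p (env n c d a k u v z) = Some k"
  "eval (var 5) p (env n c d a k u v z) = Some u"
  "eval (var 6) p (env n c d a k u v z) = Some v"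
  by (simp_all add: var_def env_def numeral_eq_Suc)

abbreviation const :: "nat \<Rightarrow> prog" where
  "const k \<equiv> plus_const k Zero"

definition ev_prog :: "prog \<Rightarrow> prog \<Rightarrow> prog \<Rightarrow> prog" where
  "ev_prog c a v = Tuple Zero (Tuple c (Tuple a v))"

definition nz_prog :: "prog \<Rightarrow> prog \<Rightarrow> prog \<Rightarrow> prog" where
  "nz_prog c a n = Tuple (const 1) (Tuple c (Tuple a n))"

definition halts_below_prog :: "prog \<Rightarrow> prog" where
  "halts_below_prog n = Tuple (const 2) n"

text \<open>Codes of compound programs have the form \<open>k + 4 * v\<close> with \<open>k\<close>
  from 5 to 8.\<close>

definition node :: "nat \<Rightarrow> prog \<Rightarrow> prog" where
  "node k t = plus_const k (double (double t))"

lemma eval_judgement_progs [simp]: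
  "eval (ev_prog s t r) p y =
     Option.bind (eval s p y) (\<lambda>c. Option.bind (eval t p y) (\<lambda>a. map_option (ev c a) (eval r p y)))"
  "eval (nz_prog s t r) p y =
     Option.bind (eval s p y) (\<lambda>c. Option.bind (eval t p y) (\<lambda>a. map_option (nz c a) (eval r p y)))"
  "eval (halts_below_prog r) p y = map_option halts_below (eval r p y)"
  "eval (node k r) p y = map_option (\<lambda>v. k + 4 * v) (eval r p y)"
  by (cases "eval s p y"; cases "eval t p y"; cases "eval r p y";
      simp add: ev_prog_def nz_prog_def halts_below_prog_def node_def ev_def nz_def
      halts_below_def)+

text \<open>The oracle is \<open>join x (join f E)\<close>, where \<open>E\<close> codes the set of its zeros.\<close>

definition mem :: "prog \<Rightarrow> prog" where
  "mem t = Comp Oracle (plus_const 1 (double (plus_const 1 (double t))))"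

lemma eval_mem [simp]:
  "eval (mem t) (join x (join f E)) y = map_option E (eval t (join x (join f E)) y)"
  \<comment> \<open>Position \<open>4 * i + 3\<close> of the oracle holds \<open>E i\<close>;
    \<open>mult_Suc_right\<close> would break the form \<open>Suc (2 * n)\<close> that
    \<open>join_odd\<close> matches.\<close>
  by (cases "eval t (join x (join f E)) y") (simp_all add: mem_def del: mult_Suc_right)

text \<open>A pair \<open>(rs, c)\<close> is a rule with premises \<open>rs\<close> and conclusion \<open>c\<close>. A check returns \<open>0\<close>, the value
  sought by \<^const>\<open>Mu\<close>, iff a rule is violated.\<close>

primrec check_rule :: "prog list \<Rightarrow> prog \<Rightarrow> prog" where
  "check_rule [] c = Cond (mem c) (const 1) Zero"
| "check_rule (r # rs) c = Cond (mem r) (check_rule rs c) (const 1)"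

primrec check_rules :: "(prog list \<times> prog) list \<Rightarrow> prog" where
  "check_rules [] = const 1"
| "check_rules (r # rs) = Cond (check_rule (fst r) (snd r)) Zero (check_rules rs)"

text \<open>Same order as the conjuncts of \<open>closed_at\<close>. In the oracle
  \<open>join x (join f E)\<close>, position \<open>2 * (a + 1)\<close> holds
  \<open>x (Suc a)\<close>, position \<open>4 * a + 1\<close> holds \<open>f a\<close>, and position
  0 holds \<open>x 0\<close>, the index of the evaluated program.\<close>

definition rules :: "(prog list \<times> prog) list" where
  "rules =
    [([], ev_prog Zero (var 3) Zero),
     ([], ev_prog (const 1) (var 3) (plus_const 1 (var 3))),
     ([], ev_prog (const 2) (Tuple (var 3) (var 5)) (var 3)),
     ([], ev_prog (const 3) (Tuple (var 3) (var 5)) (var 5)),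
     ([], ev_prog (const 4) (double (var 3)) (Comp Oracle (double (plus_const 1 (var 3))))),
     ([], ev_prog (const 4) (plus_const 1 (double (var 3)))
            (Comp Oracle (plus_const 1 (double (double (var 3)))))),
     ([ev_prog (var 1) (var 3) (var 5), ev_prog (var 2) (var 3) (var 6)],
        ev_prog (node 5 (Tuple (var 1) (var 2))) (var 3) (Tuple (var 5) (var 6))),
     ([ev_prog (var 2) (var 3) (var 5), ev_prog (var 1) (var 5) (var 6)],
        ev_prog (node 6 (Tuple (var 1) (var 2))) (var 3) (var 6)),
     ([ev_prog (var 1) (var 3) (var 6)],
        ev_prog (node 7 (Tuple (var 1) (var 2))) (Tuple (var 3) Zero) (var 6)),
     ([ev_prog (node 7 (Tuple (var 1) (var 2))) (Tuple (var 3) (var 4)) (var 5),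
       ev_prog (var 2) (Tuple (var 3) (Tuple (var 4) (var 5))) (var 6)],
        ev_prog (node 7 (Tuple (var 1) (var 2))) (Tuple (var 3) (plus_const 1 (var 4))) (var 6)),
     ([], nz_prog (var 1) (var 3) Zero),
     ([nz_prog (var 1) (var 3) (var 4),
       ev_prog (var 1) (Tuple (var 3) (var 4)) (plus_const 1 (var 6))],
        nz_prog (var 1) (var 3) (plus_const 1 (var 4))),
     ([nz_prog (var 1) (var 3) (var 4), ev_prog (var 1) (Tuple (var 3) (var 4)) Zero],
        ev_prog (node 8 (var 1)) (var 3) (var 4)),
     ([], halts_below_prog Zero),
     ([halts_below_prog (var 4), ev_prog (Comp Oracle Zero) (var 4) (var 6)],
        halts_below_prog (plus_const 1 (var 4)))]"

text \<open>The uses of \<open>the\<close> are harmless for \<open>rules\<close>, by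
  \<open>total_at_rules\<close>.\<close>

definition violated :: "baire \<Rightarrow> baire \<Rightarrow> baire \<Rightarrow> nat \<Rightarrow> prog list \<times> prog \<Rightarrow> bool" where
  "violated x f E y r \<longleftrightarrow>
     (\<forall>s\<in>set (fst r). E (the (eval s (join x (join f E)) y)) = 0) \<and>
     E (the (eval (snd r) (join x (join f E)) y)) \<noteq> 0"

definition total_at :: "baire \<Rightarrow> nat \<Rightarrow> prog list \<times> prog \<Rightarrow> bool" where
  "total_at p y r \<longleftrightarrow> (\<forall>s\<in>set (snd r # fst r). eval s p y \<noteq> None)"

lemma eval_check_rule:
  assumes "total_at (join x (join f E)) y (rs, c)"
  shows "eval (check_rule rs c) (join x (join f E)) y =
    Some (if violated x f E y (rs, c) then 0 else 1)"
  using assms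
proof (induction rs)
  case Nil
  then show ?case by (auto simp: total_at_def violated_def intro!: eval_Cond[THEN trans])
next
  case (Cons r rs)
  then obtain k where "eval r (join x (join f E)) y = Some k"
    by (auto simp: total_at_def)
  then have "eval (mem r) (join x (join f E)) y = Some (E k)" by simp
  moreover have "eval (check_rule rs c) (join x (join f E)) y =
      Some (if violated x f E y (rs, c) then 0 else 1)"
    using Cons by (simp add: total_at_def)
  moreover have "eval (const 1) (join x (join f E)) y = Some 1" by simp
  ultimately have "eval (check_rule (r # rs) c) (join x (join f E)) y =
      Some (if E k = 0 then if violated x f E y (rs, c) then 0 else 1 else 1)"
    unfolding check_rule.simps by (rule eval_Cond)
  then show ?case
    using \<open>eval r _ _ = Some k\<close> by (simp add: violated_def)
qed

lemma eval_check_rules: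
  assumes "\<forall>r\<in>set rs. total_at (join x (join f E)) y r"
  shows "eval (check_rules rs) (join x (join f E)) y =
    Some (if \<exists>r\<in>set rs. violated x f E y r then 0 else 1)"
  using assms
proof (induction rs)
  case (Cons r rs)
  then have "eval (check_rule (fst r) (snd r)) (join x (join f E)) y =
      Some (if violated x f E y r then 0 else 1)"
    using eval_check_rule[of x f E y "fst r" "snd r"] by simp
  with Cons show ?case by (auto simp: eval_Cond)
qed simp

lemma total_at_rules: "\<forall>r\<in>set rules. total_at p (env n c d a k u v z) r"
  by (simp add: rules_def total_at_def)

lemma join_Suc_4: "join x (join f E) (Suc (4 * a)) = f a"
  by (simp add: join_def)

text \<open>The rules read entries 1 to 6 of the environment, so \<open>n\<close> can be arbitrary;
  entry 0 carries the input of \<open>search\<close>.\<close>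

lemma closed_at_iff_not_violated:
  "closed_at x f {k. E k = 0} c d a k u v \<longleftrightarrow>
     \<not> (\<exists>z. \<exists>r\<in>set rules. violated x f E (env n c d a k u v z) r)"
  by (simp add: rules_def violated_def closed_at_def join_Suc_4 imp_conv_disj disj_assoc
      del: add_2_eq_Suc mult_Suc_right)

lemma eval_closed_iff_not_violated:
  "eval_closed x f {k. E k = 0} \<longleftrightarrow>
     \<not> (\<exists>c d a k u v z. \<exists>r\<in>set rules. violated x f E (env n c d a k u v z) r)"
  unfolding eval_closed_def closed_at_iff_not_violated[where n = n] by blast

definition search :: prog where
  "search = Mu (Cond (mem (halts_below_prog (var 0))) Zero (check_rules rules))"

text \<open>The search stops at once if \<open>E\<close> accepts \<open>halts_below n\<close>, and
  otherwise exactly when it meets a violated instance of a rule.\<close>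

lemma dom_search:
  "n \<in> dom (eval search (join x (join f E))) \<longleftrightarrow>
     (eval_closed x f {k. E k = 0} \<longrightarrow> E (halts_below n) = 0)"
proof -
  let ?c = "Cond (mem (halts_below_prog (var 0))) Zero (check_rules rules)"
  let ?q = "join x (join f E)"
  have c: "eval ?c ?q (env n c d a k u v z) = Some (if E (halts_below n) = 0 then 0
      else if \<exists>r\<in>set rules. violated x f E (env n c d a k u v z) r then 0 else 1)"
    for c d a k u v z
    by (subst eval_Cond) (auto simp: eval_check_rules total_at_rules)
  \<comment> \<open>Every \<open>w\<close> decodes to an environment, so the check is total and
    \<open>Mu\<close> halts as soon as some zero exists.\<close>
  have "eval ?c ?q (prod_encode (n, w)) \<noteq> None" for w
    using ex_env[of "\<lambda>y. eval ?c ?q y = None" n] c by auto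
  then have "n \<in> dom (eval search ?q) \<longleftrightarrow> (\<exists>w. eval ?c ?q (prod_encode (n, w)) = Some 0)"
    by (auto simp: search_def domIff)
  also have "\<dots> \<longleftrightarrow> (\<exists>c d a k u v z. eval ?c ?q (env n c d a k u v z) = Some 0)"
    by (rule ex_env)
  also have "\<dots> \<longleftrightarrow> (eval_closed x f {k. E k = 0} \<longrightarrow> E (halts_below n) = 0)"
    unfolding c eval_closed_iff_not_violated[of x f E n] by (auto split: if_splits)
  finally show ?thesis .
qed

text \<open>One function quantifier splits into two, for \<open>f\<close> and \<open>E\<close>. The
  bounded quantifier over \<open>m < n\<close> sits inside the judgement
  \<open>halts_below n\<close>.\<close>

lemma uniformly_Pi11_lessThan_subset: "uniformly_Pi11 (\<lambda>n. {x. {..<n} \<subseteq> delta_Pi11 x})"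
  unfolding uniformly_Pi11_def
proof (intro exI allI)
  fix n x
  define q where "q f = join (\<lambda>n. x (Suc n)) f" for f
  have join_split: "\<exists>f E. g = join f E" for g
    by (rule exI[of _ "\<lambda>n. g (2 * n)"], rule exI[of _ "\<lambda>n. g (Suc (2 * n))"])
      (auto simp: join_def fun_eq_iff)
  have "n \<in> Pi11_set search x \<longleftrightarrow> (\<forall>f E. n \<in> dom (eval search (join x (join f E))))"
    unfolding Pi11_set_def mem_Collect_eq by (metis join_split)
  also have "\<dots> \<longleftrightarrow> (\<forall>f. {..<n} \<subseteq> dom (eval (prog_of (x 0)) (q f)))"
  proof (intro iffI allI)
    fix f
    \<comment> \<open>The decisive choice of \<open>E\<close>: the set of true judgements is closed,
      so whatever all closed sets contain is true.\<close>
    define E :: baire where "E k = (if k \<in> true_judgements (x 0) (q f) then 0 else 1)" for k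
    assume "\<forall>f E. n \<in> dom (eval search (join x (join f E)))"
    then have "eval_closed x f {k. E k = 0} \<longrightarrow> E (halts_below n) = 0"
      unfolding dom_search by blast
    moreover have E: "{k. E k = 0} = true_judgements (x 0) (q f)"
      by (auto simp: E_def)
    have "eval_closed x f {k. E k = 0}"
      unfolding E q_def by (rule eval_closed_true_judgements)
    ultimately have "halts_below n \<in> {k. E k = 0}" by simp
    then have "halts_below n \<in> true_judgements (x 0) (q f)" by (simp only: E)
    then show "{..<n} \<subseteq> dom (eval (prog_of (x 0)) (q f))" by simp
  next
    fix f E
    assume "\<forall>f. {..<n} \<subseteq> dom (eval (prog_of (x 0)) (q f))"
    then show "n \<in> dom (eval search (join x (join f E)))"
      using eval_closed_halts_below[of x f "{k. E k = 0}" n] by (auto simp: dom_search q_def)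
  qed
  also have "\<dots> \<longleftrightarrow> {..<n} \<subseteq> delta_Pi11 x"
    by (auto simp: delta_Pi11_def Pi11_set_def q_def)
  finally show "x \<in> {x. {..<n} \<subseteq> delta_Pi11 x} \<longleftrightarrow> n \<in> Pi11_set search x"
    by simp
qed

section \<open>Completeness\<close>

lemma Sigma11_LNP_in_class: "Sigma11_LNP \<circ>\<^sub>m rep_Sigma11 \<in> up_D_omega_Sigma01_Pi11"
proof -
  define B where "B n = {x. {..<n} \<subseteq> delta_Pi11 x}" for n
  have "up_diff (\<lambda>n x. Some n) B x = (Sigma11_LNP \<circ>\<^sub>m rep_Sigma11) x" for x
  proof (cases "delta_Pi11 x = UNIV")
    \<comment> \<open>All \<open>B n\<close> contain \<open>x\<close>, so there is no maximum, and
      the complement is empty: both sides are undefined.\<close>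
    case True
    then show ?thesis
      by (simp add: up_diff_def B_def map_comp_def rep_Sigma11_def Sigma11_LNP_def
          delta_Sigma11_def)
  next
    case False
    define m where "m = (LEAST n. n \<notin> delta_Pi11 x)"
    have m: "m \<notin> delta_Pi11 x" using False unfolding m_def by (metis LeastI UNIV_eq_I)
    have "k \<in> delta_Pi11 x" if "k < m" for k
      using not_less_Least that unfolding m_def by blast
    \<comment> \<open>\<open>B m\<close> only concerns numbers below \<open>m\<close>, so the
      missing point \<open>m\<close> first excludes \<open>x\<close> from
      \<open>B (Suc m)\<close>.\<close>
    then have "x \<in> B n \<longleftrightarrow> n \<le> m" for n
      using m by (force simp: B_def not_less[symmetric])
    then have "{n. x \<in> B n} = {..m}" by auto
    moreover have "Max {..m} = m" by (rule Max_eqI) auto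
    ultimately show ?thesis using False
      by (auto simp: up_diff_def map_comp_def rep_Sigma11_def Sigma11_LNP_def
          delta_Sigma11_def m_def)
  qed
  moreover have "antimono B" by (auto simp: antimono_def B_def)
  moreover have "uniformly_Pi11 B"
    unfolding B_def by (rule uniformly_Pi11_lessThan_subset)
  moreover have "computable_sequence (\<lambda>n x. Some n)"
    unfolding computable_sequence_def by (rule exI[of _ Id_prog]) simp
  ultimately show ?thesis
    unfolding up_D_omega_Sigma01_Pi11_def by (auto simp: fun_eq_iff intro!: exI)
qed

lemma up_diff_le_Sigma11_LNP:
  assumes B: "antimono B" "uniformly_Pi11 B" and f: "computable_sequence f"
  shows "weihrauch_le rep_baire rep_nat (\<lambda>x. set_option (up_diff f B x))
           rep_Sigma11 rep_nat (\<lambda>A. set_option (Sigma11_LNP A))"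
proof -
  obtain c where c: "\<And>n x. x \<in> B n \<longleftrightarrow> n \<in> Pi11_set c x"
    using B(2) by (auto simp: uniformly_Pi11_def)
  obtain d where d: "\<And>n x. f n x = eval d x n"
    using f by (auto simp: computable_sequence_def)
  \<comment> \<open>The shift by \<open>Succ\<close> makes the least \<open>n\<close> with
    \<open>x \<notin> B (Suc n)\<close> equal to the maximal index itself.\<close>
  define e where "e = code (Comp c Succ)"
  \<comment> \<open>Prepends \<open>e\<close> to the oracle: the base gives entry 0, and the step
    from \<open>i\<close> reads \<open>x i\<close>.\<close>
  define h where "h = Comp (Primrec (const e) (Comp Oracle (Comp First Second))) (Tuple Zero Id_prog)"
  \<comment> \<open>Position 1 of \<open>join x r\<close> holds the answer \<open>r 0\<close>;
    \<open>d\<close> runs on it with oracle calls sent to the even positions, which hold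
    \<open>x\<close>. The output is a constant sequence.\<close>
  define k where "k = Comp (subst_oracle (Comp Oracle (double Id_prog)) d) (Comp Oracle (const 1))"
  have "rec_nat (Some e) (\<lambda>i r. Option.bind r (\<lambda>v. Some (x i))) n = Some (case_nat e x n)"
    for n and x :: baire
    by (induction n) auto
  then have h: "eval_baire h x = Some (case_nat e x)" for x
    by (simp add: eval_baire_def h_def)
  have k: "eval k (join x r) n = f (r 0) x" for x r n
  proof -
    have "join x r (Suc 0) = r 0" using join_odd[of x r 0] by simp
    then show ?thesis
      by (simp add: k_def d eval_subst_oracle[where q = x])
  qed
  have delta: "delta_Sigma11 (case_nat e x) = {n. x \<notin> B (Suc n)}" for x
    by (simp add: delta_Sigma11_def delta_Pi11_def Pi11_set_def c e_def dom_def Compl_eq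
        del: code.simps)
  show ?thesis
    unfolding weihrauch_le_def
  proof (intro exI conjI allI impI)
    show "partial_computable (eval_baire h)" "partial_computable (eval_baire k)"
      by (auto simp: partial_computable_def)
  next
    fix p x
    assume *: "rep_baire p = Some x \<and> set_option (up_diff f B x) \<noteq> {}"
    then have p: "p = x" by (simp add: rep_baire_def)
    define m where "m = Max {n. x \<in> B n}"
    have fin: "finite {n. x \<in> B n}" and ne: "{n. x \<in> B n} \<noteq> {}"
      using * by (auto simp: up_diff_def split: if_splits)
    then have g: "up_diff f B x = f m x" by (simp add: up_diff_def m_def)
    define v where "v = the (f m x)"
    have v: "f m x = Some v" using * g by (auto simp: v_def)
    have "x \<in> B m" using Max_in[OF fin ne] by (simp add: m_def)
    then have below: "x \<in> B n" if "n \<le> m" for n using B(1) that by (auto dest: antimonoD)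
    have "x \<notin> B n" if "m < n" for n using Max_ge[OF fin, of n] that by (auto simp: m_def)
    \<comment> \<open>As \<open>B\<close> is decreasing, \<open>x\<close> lies in all
      \<open>B i\<close> with \<open>i \<le> m\<close>, which forces
      \<open>m < Suc n\<close>.\<close>
    moreover have "m \<le> n" if "x \<notin> B (Suc n)" for n
      using below that not_less_eq_eq by blast
    ultimately have "Sigma11_LNP (delta_Sigma11 (case_nat e x)) = Some m"
      unfolding delta Sigma11_LNP_def by (auto intro!: Least_equality)
    moreover have "eval_baire k (join x r) = Some (\<lambda>_. v)" if "r 0 = m" for r
      by (simp add: eval_baire_def k that v)
    ultimately show "eval_baire h p = Some (case_nat e x)"
      "rep_Sigma11 (case_nat e x) = Some (delta_Sigma11 (case_nat e x))"
      "set_option (Sigma11_LNP (delta_Sigma11 (case_nat e x))) \<noteq> {}"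
      "\<And>r w. rep_nat r = Some w \<and> w \<in> set_option (Sigma11_LNP (delta_Sigma11 (case_nat e x))) \<Longrightarrow>
        eval_baire k (join p r) = Some (\<lambda>_. v)"
      "rep_nat (\<lambda>_. v) = Some v" "v \<in> set_option (up_diff f B x)"
      by (auto simp: h p rep_Sigma11_def rep_nat_def g v)
  qed
qed

theorem proposition3p5:
  "complete_for up_D_omega_Sigma01_Pi11 rep_Sigma11 Sigma11_LNP"
  unfolding complete_for_def
proof (intro conjI ballI)
  show "Sigma11_LNP \<circ>\<^sub>m rep_Sigma11 \<in> up_D_omega_Sigma01_Pi11"
    by (rule Sigma11_LNP_in_class)
next
  fix g
  assume "g \<in> up_D_omega_Sigma01_Pi11"
  then show "weihrauch_le rep_baire rep_nat (\<lambda>x. set_option (g x))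
      rep_Sigma11 rep_nat (\<lambda>A. set_option (Sigma11_LNP A))"
    unfolding up_D_omega_Sigma01_Pi11_def using up_diff_le_Sigma11_LNP by blast
qed

end
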